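(* Let $P_0\in\mathbb{C}^{d\times d}$ be Hermitian and strictly positive definite, and for $k\ge1$ let $$K_k=P_{k-1}\widetilde{H}_{k-1}^*\left(\widetilde{H}_{k-1}P_{k-1}\widetilde{H}_{k-1}^*+R_{k-1}\right)^{-1},\qquad P_k=P_{k-1}-K_k\widetilde{H}_{k-1}P_{k-1},\qquad \Psi_k=\mathbb{I}-K_k\widetilde{H}_{k-1}.$$ Then the zero solution of the system $$z(k)=\Psi_kz(k-1),\qquad z(0)=z_0,$$ is (Lyapunov) stable.
   Context: Let $m<d$ be positive integers. For each $k$, $A_k\in\mathbb{C}^{d\times d}$ is invertible and $H_k\in\mathbb{C}^{m\times d}$; the $R_k$ ($k\ge0$) are $m\times m$ real symmetric positive definite matrices and there is a fixed $\sigma^2>0$ with $R_k\ge\sigma^2\mathbb{I}$ for all $k\ge0$ (Loewner order; $\mathbb{I}$ is the identity matrix). Set $A(0,0)=\mathbb{I}$, $A(k,0)=A_kA_{k-1}\cdots A_1$ for $k\ge1$, and $\widetilde{H}_k=H_kA(k,0)$. (These data come from the system $x(k+1)=A_{k+1}x(k)$, $y(k)=H_kx(k)+v_k$ with noise $v_k\sim N(0,R_k)$.) The superscript $^*$ denotes conjugate transpose. The zero solution of $z(k)=\Psi_kz(k-1)$ is Lyapunov stable if for every $\epsilon>0$ and every initial time $k_0$ there is $\delta=\delta(\epsilon,k_0)>0$ such that every solution started at time $k_0$ with $z(k_0)=z_0$, $\|z_0\|<\delta$, satisfies $\|z(k)\|<\epsilon$ for all $k\ge k_0$. *)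

theory Defs
  imports "HOL-Analysis.Analysis"
begin

definition conj_transpose :: "complex^'n^'m \<Rightarrow> complex^'m^'n" where
  "conj_transpose M = (\<chi> i j. cnj (M $ j $ i))"

definition complex_matrix :: "real^'n^'m \<Rightarrow> complex^'n^'m" where
  "complex_matrix M = (\<chi> i j. complex_of_real (M $ i $ j))"

definition hermitian :: "complex^'n^'n \<Rightarrow> bool" where
  "hermitian M \<longleftrightarrow> conj_transpose M = M"

(* The number x^* M x; it is real whenever M is Hermitian. *)
definition quad_form :: "complex^'n^'n \<Rightarrow> complex^'n \<Rightarrow> complex" where
  "quad_form M x = (\<Sum>i\<in>UNIV. cnj (x $ i) * (M *v x) $ i)"

definition hermitian_pos_def :: "complex^'n^'n \<Rightarrow> bool" where
  "hermitian_pos_def M \<longleftrightarrow> hermitian M \<and> (\<forall>x. x \<noteq> 0 \<longrightarrow> 0 < Re (quad_form M x))"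

definition symmetric_pos_def :: "real^'n^'n \<Rightarrow> bool" where
  "symmetric_pos_def M \<longleftrightarrow> transpose M = M \<and> (\<forall>x. x \<noteq> 0 \<longrightarrow> 0 < x \<bullet> (M *v x))"

definition symmetric_pos_semidef :: "real^'n^'n \<Rightarrow> bool" where
  "symmetric_pos_semidef M \<longleftrightarrow> transpose M = M \<and> (\<forall>x. 0 \<le> x \<bullet> (M *v x))"

definition loewner_le :: "real^'n^'n \<Rightarrow> real^'n^'n \<Rightarrow> bool" where
  "loewner_le M N \<longleftrightarrow> symmetric_pos_semidef (N - M)"

(* The matrix A(k,0) = A_k ... A_1; the value A 0 is never used. *)
primrec transition :: "(nat \<Rightarrow> complex^'n^'n) \<Rightarrow> nat \<Rightarrow> complex^'n^'n" where
  "transition A 0 = mat 1"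
| "transition A (Suc k) = A (Suc k) ** transition A k"

(* Solutions started at time k0 are represented by total sequences; their values before k0
   are unconstrained and play no role. The equation is z(k) = Psi_k z(k-1) for k > k0, so
   Psi 0 is never used. *)
definition lyapunov_stable :: "(nat \<Rightarrow> complex^'n^'n) \<Rightarrow> bool" where
  "lyapunov_stable \<Psi> \<longleftrightarrow>
     (\<forall>\<epsilon>>0. \<forall>k0. \<exists>\<delta>>0. \<forall>z :: nat \<Rightarrow> complex^'n.
        (\<forall>k>k0. z k = \<Psi> k *v z (k - 1)) \<and> norm (z k0) < \<delta> \<longrightarrow>
        (\<forall>k\<ge>k0. norm (z k) < \<epsilon>))"

end

theory Submission
  imports Defs
begin

text \<open>
  Since \<open>P\<^sub>k = \<Psi>\<^sub>k P\<^sub>k\<^sub>-\<^sub>1\<close>, a solution started at time \<open>k\<^sub>0\<close> is \<open>z k = P\<^sub>k w\<close> with the constant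
  vector \<open>w = P\<^bsub>k\<^sub>0\<^esub>\<inverse> z k\<^sub>0\<close>. The Joseph form \<open>P\<^sub>k = \<Psi>\<^sub>k P\<^sub>k\<^sub>-\<^sub>1 \<Psi>\<^sub>k\<^sup>* + K\<^sub>k R\<^sub>k\<^sub>-\<^sub>1 K\<^sub>k\<^sup>*\<close> shows that every
  \<open>P\<^sub>k\<close> is positive definite, and the update subtracts a positive semidefinite matrix, so the
  \<open>P\<^sub>k\<close> decrease in the Loewner order. Hence their norms are bounded uniformly in \<open>k\<close>.
\<close>

section \<open>Complex matrix algebra and conjugate transposes\<close>

lemma Re_quad_form: "Re (quad_form M x) = x \<bullet> (M *v x)"
  by (simp add: quad_form_def inner_vec_def inner_complex_def)

lemma matrix_diff_ldistrib: "A ** (B - C) = A ** B - A ** (C :: 'a::ring_1^'n^'m)"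
  by (simp add: matrix_matrix_mult_def vec_eq_iff right_diff_distrib sum_subtractf)

lemma matrix_diff_rdistrib: "(A - B) ** C = A ** C - B ** (C :: 'a::ring_1^'n^'m)"
  by (simp add: matrix_matrix_mult_def vec_eq_iff left_diff_distrib sum_subtractf)

lemma matrix_add_rdistrib: "(A + B) ** C = A ** C + B ** (C :: 'a::semiring_1^'n^'m)"
  by (simp add: matrix_matrix_mult_def vec_eq_iff distrib_right sum.distrib)

text \<open>The real inner product on complex vectors is the real part of the Hermitian one, so the
  usual adjoint rule, an exchange of two sums, carries over.\<close>

lemma inner_matrix_vector_mult_conj_transpose:
  fixes M :: "complex^'n^'m"
  shows "x \<bullet> (M *v y) = (conj_transpose M *v x) \<bullet> y"
proof -
  have inner: "u \<bullet> v = Re (\<Sum>i\<in>UNIV. cnj (u $ i) * v $ i)" for u v :: "complex^'k"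
    by (simp add: inner_vec_def inner_complex_def)
  have "(\<Sum>i\<in>UNIV. cnj (x $ i) * (M *v y) $ i)
      = (\<Sum>j\<in>UNIV. cnj ((conj_transpose M *v x) $ j) * y $ j)"
    by (simp add: matrix_vector_mult_def conj_transpose_def sum_distrib_left sum_distrib_right
        mult.assoc mult.left_commute) (rule sum.swap)
  then show ?thesis
    by (simp only: inner)
qed

lemma conj_transpose_conj_transpose [simp]: "conj_transpose (conj_transpose M) = M"
  by (simp add: conj_transpose_def vec_eq_iff)

lemma conj_transpose_mat_1 [simp]: "conj_transpose (mat 1) = mat 1"
  by (simp add: conj_transpose_def mat_def vec_eq_iff)

lemma conj_transpose_add: "conj_transpose (M + N) = conj_transpose M + conj_transpose N"
  by (simp add: conj_transpose_def vec_eq_iff)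

lemma conj_transpose_diff: "conj_transpose (M - N) = conj_transpose M - conj_transpose N"
  by (simp add: conj_transpose_def vec_eq_iff)

lemma conj_transpose_mult: "conj_transpose (M ** N) = conj_transpose N ** conj_transpose M"
  by (simp add: conj_transpose_def matrix_matrix_mult_def vec_eq_iff mult.commute)

section \<open>Positive definite Hermitian matrices\<close>

lemma hermitian_pos_def_iff:
  "hermitian_pos_def M \<longleftrightarrow> conj_transpose M = M \<and> (\<forall>x. x \<noteq> 0 \<longrightarrow> 0 < x \<bullet> (M *v x))"
  by (simp add: hermitian_pos_def_def hermitian_def Re_quad_form)

lemma hermitian_pos_def_inner_nonneg:
  "hermitian_pos_def M \<Longrightarrow> 0 \<le> x \<bullet> (M *v x)"
  by (cases "x = 0") (auto simp: hermitian_pos_def_iff less_imp_le)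

lemma matrix_inv_right_left:
  fixes M :: "'a::semiring_1^'n^'n"
  assumes "invertible M"
  shows "M ** matrix_inv M = mat 1" "matrix_inv M ** M = mat 1"
  using someI_ex[OF assms[unfolded invertible_def]] by (auto simp: matrix_inv_def)

lemma hermitian_pos_def_invertible:
  assumes "hermitian_pos_def M"
  shows "invertible M"
proof -
  have "x = 0" if "M *v x = 0" for x
    using assms that by (force simp: hermitian_pos_def_iff)
  then show ?thesis
    by (metis invertible_left_inverse matrix_left_invertible_ker)
qed

text \<open>With \<open>y = matrix_inv M *v x\<close>, the form of the inverse at \<open>x\<close>
  is the form of \<open>M\<close> at \<open>y\<close>.\<close>

lemma hermitian_pos_def_matrix_inv:
  assumes "hermitian_pos_def M"
  shows "hermitian_pos_def (matrix_inv M)"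
proof -
  let ?N = "matrix_inv M"
  note inv = matrix_inv_right_left[OF hermitian_pos_def_invertible[OF assms]]
  have M: "conj_transpose M = M"
    using assms by (simp add: hermitian_pos_def_iff)
  have "conj_transpose ?N ** M = mat 1"
    using arg_cong[OF inv(1), of conj_transpose] by (simp add: conj_transpose_mult M)
  then have N: "conj_transpose ?N = ?N"
    by (metis inv(1) matrix_mul_assoc matrix_mul_lid matrix_mul_rid)
  have "0 < x \<bullet> (?N *v x)" if "x \<noteq> 0" for x
  proof -
    have x: "M *v (?N *v x) = x"
      by (simp add: matrix_vector_mul_assoc inv)
    then have "?N *v x \<noteq> 0"
      using that by force
    then have "0 < (?N *v x) \<bullet> (M *v (?N *v x))"
      using assms by (simp add: hermitian_pos_def_iff)
    then show ?thesis
      by (simp add: x inner_commute)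
  qed
  with N show ?thesis
    by (simp add: hermitian_pos_def_iff)
qed

text \<open>For \<open>x = a + i b\<close> with real \<open>a\<close> and \<open>b\<close>, the
  cross terms are purely imaginary, so the real form splits into the values of \<open>M\<close> at
  \<open>a\<close> and \<open>b\<close>.\<close>

lemma hermitian_pos_def_complex_matrix:
  assumes "symmetric_pos_def M"
  shows "hermitian_pos_def (complex_matrix M)"
proof -
  have "M $ j $ i = M $ i $ j" for i j
    using assms by (auto simp: symmetric_pos_def_def transpose_def vec_eq_iff)
  then have "conj_transpose (complex_matrix M) = complex_matrix M"
    by (simp add: conj_transpose_def complex_matrix_def vec_eq_iff)
  moreover have "0 < x \<bullet> (complex_matrix M *v x)" if "x \<noteq> 0" for x
  proof -
    define a b where "a = (\<chi> i. Re (x $ i))" and "b = (\<chi> i. Im (x $ i))"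
    have "x \<bullet> (complex_matrix M *v x) = a \<bullet> (M *v a) + b \<bullet> (M *v b)"
      by (simp add: a_def b_def inner_vec_def inner_complex_def complex_matrix_def
          matrix_vector_mult_def sum.distrib)
    moreover have "a \<noteq> 0 \<or> b \<noteq> 0"
      using that by (auto simp: a_def b_def vec_eq_iff complex_eq_iff)
    moreover have "0 \<le> c \<bullet> (M *v c)" "c \<noteq> 0 \<Longrightarrow> 0 < c \<bullet> (M *v c)" for c
      using assms by (cases "c = 0"; force simp: symmetric_pos_def_def less_imp_le)+
    ultimately show ?thesis
      by (metis add_nonneg_pos add_pos_nonneg)
  qed
  ultimately show ?thesis
    by (simp add: hermitian_pos_def_iff)
qed

section \<open>One step of the covariance recursion\<close>

context
  fixes P :: "complex^'d^'d" and H :: "complex^'d^'m" and R S :: "complex^'m^'m"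
    and K :: "complex^'m^'d"
  assumes P: "hermitian_pos_def P" and R: "hermitian_pos_def R"
    and S: "S = H ** P ** conj_transpose H + R"
    and K: "K = P ** conj_transpose H ** matrix_inv S"
begin

text \<open>Strictness comes from \<open>R\<close>: the term with \<open>P\<close> vanishes wherever
  \<open>conj_transpose H *v x = 0\<close>.\<close>

lemma innovation_covariance_pos_def: "hermitian_pos_def S"
proof -
  have "conj_transpose S = S"
    using P R by (simp add: S hermitian_pos_def_iff conj_transpose_add conj_transpose_mult matrix_mul_assoc)
  moreover have "0 < x \<bullet> (S *v x)" if "x \<noteq> 0" for x
  proof -
    have "x \<bullet> (S *v x) = (conj_transpose H *v x) \<bullet> (P *v (conj_transpose H *v x)) + x \<bullet> (R *v x)"
      by (simp add: S matrix_vector_mult_add_rdistrib inner_add_right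
          inner_matrix_vector_mult_conj_transpose[of x H] flip: matrix_vector_mul_assoc)
    then show ?thesis
      using hermitian_pos_def_inner_nonneg[OF P, of "conj_transpose H *v x"] R that
      by (simp add: hermitian_pos_def_iff add_nonneg_pos)
  qed
  ultimately show ?thesis
    by (simp add: hermitian_pos_def_iff)
qed

lemma gain_mult_innovation_covariance: "K ** S = P ** conj_transpose H"
  by (simp add: K matrix_inv_right_left[OF hermitian_pos_def_invertible[OF innovation_covariance_pos_def]]
      flip: matrix_mul_assoc)

text \<open>Positivity is hidden in the difference on the left but visible in the sum of congruences
  on the right. On expansion, the terms quadratic in \<open>K\<close> collect to
  \<open>K ** S ** conj_transpose K\<close>, which the gain identity cancels against
  \<open>P ** conj_transpose H ** conj_transpose K\<close>.\<close>

lemma joseph_form: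
  defines "\<Psi> \<equiv> mat 1 - K ** H"
  shows "P - K ** H ** P = \<Psi> ** P ** conj_transpose \<Psi> + K ** R ** conj_transpose K"
proof -
  have "\<Psi> ** P ** conj_transpose \<Psi> + K ** R ** conj_transpose K
      = P - K ** H ** P - P ** conj_transpose H ** conj_transpose K + K ** S ** conj_transpose K"
    by (simp add: \<Psi>_def S conj_transpose_diff conj_transpose_mult matrix_diff_ldistrib
        matrix_diff_rdistrib matrix_add_ldistrib matrix_add_rdistrib matrix_mul_assoc)
  then show ?thesis
    by (simp add: gain_mult_innovation_covariance)
qed

lemma covariance_update_pos_def: "hermitian_pos_def (P - K ** H ** P)"
proof -
  let ?F = "mat 1 - K ** H"
  have "conj_transpose (P - K ** H ** P) = P - K ** H ** P"
    unfolding joseph_form using P R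
    by (simp add: hermitian_pos_def_iff conj_transpose_add conj_transpose_mult matrix_mul_assoc)
  moreover have "0 < x \<bullet> ((P - K ** H ** P) *v x)" if "x \<noteq> 0" for x
  proof -
    let ?u = "conj_transpose ?F *v x" and ?v = "conj_transpose K *v x"
    have eq: "x \<bullet> ((P - K ** H ** P) *v x) = ?u \<bullet> (P *v ?u) + ?v \<bullet> (R *v ?v)"
      unfolding joseph_form
      by (simp add: matrix_vector_mult_add_rdistrib inner_add_right
          inner_matrix_vector_mult_conj_transpose[of x ?F]
          inner_matrix_vector_mult_conj_transpose[of x K] flip: matrix_vector_mul_assoc)
    \<comment> \<open>By definition \<open>?u\<close> is \<open>x - conj_transpose H *v ?v\<close>,
      so \<open>?u\<close> and \<open>?v\<close> cannot both vanish; this makes the sum of the two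
      forms strictly positive.\<close>
    have "x = ?u + conj_transpose H *v ?v"
      by (simp add: conj_transpose_diff conj_transpose_mult matrix_vector_mult_diff_rdistrib
          matrix_vector_mul_assoc)
    with that have "?u \<noteq> 0 \<or> ?v \<noteq> 0"
      by force
    then show ?thesis
      using hermitian_pos_def_inner_nonneg[OF P, of ?u] hermitian_pos_def_inner_nonneg[OF R, of ?v]
        P R unfolding eq hermitian_pos_def_iff by (metis add_nonneg_pos add_pos_nonneg)
  qed
  ultimately show ?thesis
    by (simp add: hermitian_pos_def_iff)
qed

text \<open>The subtracted matrix is \<open>P ** conj_transpose H ** matrix_inv S ** H ** P\<close>,
  a congruence of the positive definite \<open>matrix_inv S\<close> because \<open>P\<close> is
  Hermitian.\<close>

lemma covariance_update_le: "x \<bullet> ((P - K ** H ** P) *v x) \<le> x \<bullet> (P *v x)"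
proof -
  let ?y = "H *v (P *v x)"
  have "x \<bullet> ((K ** H ** P) *v x) = ?y \<bullet> (matrix_inv S *v ?y)"
    using P by (simp add: K inner_matrix_vector_mult_conj_transpose[of x P] hermitian_pos_def_iff
        inner_matrix_vector_mult_conj_transpose[of _ "conj_transpose H"]
        flip: matrix_vector_mul_assoc)
  then show ?thesis
    using hermitian_pos_def_inner_nonneg[OF hermitian_pos_def_matrix_inv[OF
          innovation_covariance_pos_def], of ?y]
    by (simp add: matrix_vector_mult_diff_rdistrib inner_diff_right)
qed

end

text \<open>This turns a Loewner bound into an operator norm bound with the same constant, so a
  bound on the forms that is uniform in \<open>k\<close> stays uniform for the norms.\<close>

lemma norm_matrix_vector_mult_le:
  assumes M: "hermitian_pos_def M" and le: "\<And>x. x \<bullet> (M *v x) \<le> C * (norm x)\<^sup>2"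
  shows "norm (M *v x) \<le> C * norm x"
proof (cases "M *v x = 0 \<or> x = 0")
  case True
  then show ?thesis
    using le[of x] hermitian_pos_def_inner_nonneg[OF M, of x]
    by (auto simp: zero_le_mult_iff)
next
  case False
  define u where "u = (norm x / norm (M *v x)) *\<^sub>R (M *v x)"
  have norm_u: "norm u = norm x"
    using False by (simp add: u_def)
  have sym: "x \<bullet> (M *v u) = u \<bullet> (M *v x)"
    using M by (metis hermitian_pos_def_iff inner_commute inner_matrix_vector_mult_conj_transpose)
  \<comment> \<open>Polarization, with \<open>u\<close> scaled so that \<open>norm u = norm x\<close>, avoids Cauchy--Schwarz for \<open>M\<close>.\<close>
  have "4 * (u \<bullet> (M *v x)) = (u + x) \<bullet> (M *v (u + x)) - (u - x) \<bullet> (M *v (u - x))"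
    by (simp add: matrix_vector_mult_diff_distrib matrix_vector_right_distrib inner_add_left
        inner_add_right inner_diff_left inner_diff_right sym)
  also have "\<dots> \<le> C * (norm (u + x))\<^sup>2"
    using le[of "u + x"] hermitian_pos_def_inner_nonneg[OF M, of "u - x"] by simp
  also have "\<dots> \<le> C * (2 * norm x)\<^sup>2"
  proof (rule mult_left_mono)
    show "(norm (u + x))\<^sup>2 \<le> (2 * norm x)\<^sup>2"
      using norm_triangle_ineq[of u x] norm_u by (intro power_mono) auto
    \<comment> \<open>The sign of \<open>C\<close> is forced by the form at the nonzero vector
      \<open>x\<close>, which lies between 0 and \<open>C * (norm x)\<^sup>2\<close>.\<close>
    have "0 \<le> C * (norm x)\<^sup>2"
      using le[of x] hermitian_pos_def_inner_nonneg[OF M, of x] by linarith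
    then show "0 \<le> C"
      using False by (simp add: zero_le_mult_iff)
  qed
  finally have "u \<bullet> (M *v x) \<le> C * norm x * norm x"
    by (simp add: power2_eq_square)
  moreover have "u \<bullet> (M *v x) = norm (M *v x) * norm x"
    using False by (simp add: u_def dot_square_norm power2_eq_square)
  ultimately show ?thesis
    using False by simp
qed

theorem theorem4p3:
  fixes A :: "nat \<Rightarrow> complex^'d^'d"
    and H Ht :: "nat \<Rightarrow> complex^'d^'m"
    and R :: "nat \<Rightarrow> real^'m^'m"
    and \<sigma> :: real
    and P \<Psi> :: "nat \<Rightarrow> complex^'d^'d"
    and K :: "nat \<Rightarrow> complex^'m^'d"
  assumes "CARD('m) < CARD('d)"
    and "\<And>k. k \<ge> 1 \<Longrightarrow> invertible (A k)"
    and "\<And>k. symmetric_pos_def (R k)"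
    and "\<sigma>\<^sup>2 > 0"
    and "\<And>k. loewner_le (\<sigma>\<^sup>2 *\<^sub>R mat 1) (R k)"
    and "\<And>k. Ht k = H k ** transition A k"
    and "hermitian_pos_def (P 0)"
    and "\<And>k. k \<ge> 1 \<Longrightarrow> K k = P (k - 1) ** conj_transpose (Ht (k - 1)) **
           matrix_inv (Ht (k - 1) ** P (k - 1) ** conj_transpose (Ht (k - 1))
                       + complex_matrix (R (k - 1)))"
    and "\<And>k. k \<ge> 1 \<Longrightarrow> P k = P (k - 1) - K k ** Ht (k - 1) ** P (k - 1)"
    and "\<And>k. k \<ge> 1 \<Longrightarrow> \<Psi> k = mat 1 - K k ** Ht (k - 1)"
  shows "lyapunov_stable \<Psi>"
proof -
  note R = hermitian_pos_def_complex_matrix[OF assms(3)]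
  have Psi: "P (Suc k) = \<Psi> (Suc k) ** P k" for k
    using assms(9,10)[of "Suc k"] by (simp add: matrix_diff_rdistrib)
  note step = assms(9)[of "Suc k" for k, simplified]
  note gain = assms(8)[of "Suc k" for k, simplified]
  have pos: "hermitian_pos_def (P k)" for k
  proof (induction k)
    case 0
    show ?case by (rule assms(7))
  next
    case (Suc k)
    then show ?case
      unfolding step by (rule covariance_update_pos_def[OF _ R refl gain])
  qed
  have decreasing: "x \<bullet> (P k *v x) \<le> x \<bullet> (P 0 *v x)" for k x
  proof (induction k)
    case (Suc k)
    have "x \<bullet> (P (Suc k) *v x) \<le> x \<bullet> (P k *v x)"
      unfolding step by (rule covariance_update_le[OF pos R refl gain])
    with Suc show ?case by simp
  qed simp
  \<comment> \<open>\<open>C\<close> is chosen for \<open>P 0\<close> only; monotonicity extends the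
    form bound to every \<open>P k\<close>.\<close>
  obtain C where "C > 0" and C: "\<And>x. norm (P 0 *v x) \<le> norm x * C"
    using bounded_linear.pos_bounded[OF matrix_vector_mul_bounded_linear] by blast
  have "x \<bullet> (P k *v x) \<le> C * (norm x)\<^sup>2" for k x
  proof -
    have "x \<bullet> (P 0 *v x) \<le> norm x * norm (P 0 *v x)"
      by (rule norm_cauchy_schwarz)
    also have "\<dots> \<le> norm x * (norm x * C)"
      by (intro mult_left_mono C) simp
    finally show ?thesis
      using decreasing[of x k] by (simp add: power2_eq_square mult_ac)
  qed
  then have norm_P: "norm (P k *v x) \<le> C * norm x" for k x
    by (rule norm_matrix_vector_mult_le[OF pos])
  show ?thesis
    unfolding lyapunov_stable_def
  proof (intro allI impI)
    fix \<epsilon> :: real and k0 :: nat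
    assume "\<epsilon> > 0"
    obtain B where "B > 0" and B: "\<And>x. norm (matrix_inv (P k0) *v x) \<le> norm x * B"
      using bounded_linear.pos_bounded[OF matrix_vector_mul_bounded_linear] by blast
    show "\<exists>\<delta>>0. \<forall>z. (\<forall>k>k0. z k = \<Psi> k *v z (k - 1)) \<and> norm (z k0) < \<delta> \<longrightarrow>
        (\<forall>k\<ge>k0. norm (z k) < \<epsilon>)"
    proof (intro exI conjI allI impI)
      \<comment> \<open>The estimate will be \<open>norm (z k) \<le> C * B * norm (z k0)\<close>.
        Only \<open>B\<close>, which bounds the inverse of \<open>P k0\<close>, depends on the
        initial time.\<close>
      show "\<epsilon> / (C * B) > 0"
        using \<open>\<epsilon> > 0\<close> \<open>C > 0\<close> \<open>B > 0\<close> by simp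
      fix z :: "nat \<Rightarrow> complex^'d" and k
      assume z: "(\<forall>k>k0. z k = \<Psi> k *v z (k - 1)) \<and> norm (z k0) < \<epsilon> / (C * B)"
        and "k0 \<le> k"
      define w where "w = matrix_inv (P k0) *v z k0"
      have "z k = P k *v w"
        using \<open>k0 \<le> k\<close>
      proof (induction k rule: dec_induct)
        case base
        show ?case
          by (simp add: w_def matrix_vector_mul_assoc
              matrix_inv_right_left(1)[OF hermitian_pos_def_invertible[OF pos]])
      next
        \<comment> \<open>Both \<open>z\<close> and \<open>P\<close> advance by
          \<open>\<Psi> (Suc n)\<close>, so the same \<open>w\<close> serves at the next
          time.\<close>
        case (step n)
        then show ?case
          using z by (simp add: Psi matrix_vector_mul_assoc)
      qed
      also have "norm (P k *v w) \<le> C * norm w"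
        by (rule norm_P)
      also have "\<dots> \<le> C * (norm (z k0) * B)"
        using B \<open>C > 0\<close> by (simp add: w_def)
      also have "\<dots> < \<epsilon>"
        using z \<open>C > 0\<close> \<open>B > 0\<close> by (simp add: field_simps)
      finally show "norm (z k) < \<epsilon>" .
    qed
  qed
qed

end
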